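(* Let $n,m\in\mathbb{N}$, let $A=M_n(\mathbb{C})$, and let $\mathfrak{g}\subseteq\mathrm{Der}(A)$ be a (complex) Lie subalgebra closed under the involution $X\mapsto X^\ast$, $X^\ast(a):=X(a^\ast)^\ast$. Let $\mathcal{E}=M_{m,n}(\mathbb{C})$ be the right $A$-module with action by matrix multiplication from the right, equipped with the hermitian structure $\langle s,t\rangle:=s^\ast t$. Then the set of observables $$\mathcal{O}=\big\{\mathcal{W}_{(X_1,\dots,X_N)}:(X_1,\dots,X_N)\in\mathfrak{g}_{\mathbb{R}}^N,\ N\in\mathbb{N}\big\}$$ is separating on the space of hermitian connections on $\mathcal{E}$ modulo gauge transformations; that is, if $\nabla,\nabla'$ are hermitian connections on $\mathcal{E}$ with $\mathcal{W}_{(X_1,\dots,X_N)}(\nabla)=\mathcal{W}_{(X_1,\dots,X_N)}(\nabla')$ for all $N\in\mathbb{N}$ and all $(X_1,\dots,X_N)\in\mathfrak{g}_{\mathbb{R}}^N$, then $\nabla$ and $\nabla'$ are gauge equivalent.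
   Context: $M_{m,n}(\mathbb{C})$ is the space of complex $m\times n$-matrices; $\ast$ on matrices is hermitian conjugation. $\mathrm{Der}(A)$ is the complex Lie algebra of $\mathbb{C}$-linear derivations of $A=M_n(\mathbb{C})$. Every derivation of $A$ is inner, and $\theta(X)$ denotes the unique traceless matrix with $X(a)=[\theta(X),a]$ for all $a\in A$. $\mathfrak{g}_{\mathbb{R}}:=\{X\in\mathfrak{g}:X^\ast=X\}$ is the real Lie algebra of real derivations in $\mathfrak{g}$ (equivalently, $\theta(X)$ is antihermitian). A connection on $\mathcal{E}$ is a family of $\mathbb{C}$-linear maps $\nabla_X:\mathcal{E}\to\mathcal{E}$, depending $\mathbb{C}$-linearly on $X\in\mathfrak{g}$, with $\nabla_X(s\,a)=(\nabla_Xs)\,a+s\,X(a)$ for all $s\in\mathcal{E}$, $a\in A$. Every connection can be written uniquely as $\nabla_Xs=-s\,\theta(X)+B(X)\,s$ with a $\mathbb{C}$-linear map $B:\mathfrak{g}\to M_m(\mathbb{C})$, called its gauge potential. The connection is hermitian if $X(\langle s,t\rangle)=\langle\nabla_{X^\ast}s,t\rangle+\langle s,\nabla_Xt\rangle$ for all $s,t\in\mathcal{E}$, $X\in\mathfrak{g}$; equivalently, $B(X^\ast)^\ast=-B(X)$ for all $X\in\mathfrak{g}$. The right $A$-linear endomorphisms of $\mathcal{E}$ are identified with $M_m(\mathbb{C})$ acting by matrix multiplication from the left, and $\mathrm{Tr}$ denotes the matrix trace on $M_m(\mathbb{C})$. The gauge group is the group of unitary endomorphisms of $\mathcal{E}$,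 identified with the unitary group $U_m\subseteq M_m(\mathbb{C})$; $u\in U_m$ acts on connections by $\nabla_X\mapsto\nabla^u_X=u\circ\nabla_X\circ u^\ast$, which on gauge potentials reads $B(X)\mapsto u\,B(X)\,u^\ast$ for all $X\in\mathfrak{g}$. Two connections are gauge equivalent if they lie in the same $U_m$-orbit. For a connection $\nabla$ and $X\in\mathfrak{g}$, the module parallel transport is $\Phi^{\nabla_X}_\tau:=e^{\tau\nabla_X}$, so $\Phi^{\nabla_X}_\tau(s)=e^{\tau B(X)}\,s\,e^{-\tau\theta(X)}$, and one sets $\widetilde{\Phi}^{\nabla_X}_\tau(s):=\Phi^{\nabla_X}_\tau(s)\,e^{\tau\theta(X)}=e^{\tau B(X)}\,s$, which is a right $A$-linear endomorphism of $\mathcal{E}$ (corresponding to $e^{\tau B(X)}\in M_m(\mathbb{C})$). For $N\in\mathbb{N}$ and $(X_1,\dots,X_N)\in\mathfrak{g}^N$ the gauge invariant observable $\mathcal{W}_{(X_1,\dots,X_N)}$ is the function from the set of connections on $\mathcal{E}$ to $\mathbb{C}$ given by $$\mathcal{W}_{(X_1,\dots,X_N)}(\nabla)=\mathrm{Tr}\big(\widetilde{\Phi}^{\nabla_{X_1}}_1\cdots\widetilde{\Phi}^{\nabla_{X_N}}_1\big).$$ *)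

theory Defs
  imports "HOL-Analysis.Analysis"
begin

text \<open>
  \<open>M\<^sub>m\<^sub>,\<^sub>n(\<complex>)\<close> is the type \<open>complex^'n^'m\<close> (\<open>m\<close> rows, \<open>n\<close> columns), so that \<open>A = M\<^sub>n(\<complex>)\<close> is
  \<open>complex^'n^'n\<close>, the module \<open>\<E>\<close> is \<open>complex^'n^'m\<close>, and its right \<open>A\<close>-linear endomorphisms are
  \<open>complex^'m^'m\<close>.  On \<open>\<E>\<close>, the right action of \<open>A\<close> and the left action of the endomorphisms
  are both \<open>**\<close>.
\<close>

definition cscale :: "complex \<Rightarrow> complex^'n^'m \<Rightarrow> complex^'n^'m" where
  "cscale c M = (\<chi> i j. c * M $ i $ j)"

definition hconj :: "complex^'n^'m \<Rightarrow> complex^'m^'n" where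
  "hconj M = (\<chi> i j. cnj (M $ j $ i))"

lemma vector_space_cscale: "vector_space (cscale :: complex \<Rightarrow> complex^'n^'m \<Rightarrow> complex^'n^'m)"
  by unfold_locales (simp_all add: cscale_def vec_eq_iff algebra_simps)

abbreviation clinear :: "(complex^'n^'m \<Rightarrow> complex^'q^'p) \<Rightarrow> bool" where
  "clinear \<equiv> Vector_Spaces.linear cscale cscale"


section \<open>Derivations of the matrix algebra\<close>

type_synonym 'n endo = "complex^'n^'n \<Rightarrow> complex^'n^'n"

definition Der :: "('n::finite) endo set" where
  "Der = {X. clinear X \<and> (\<forall>a b. X (a ** b) = X a ** b + a ** X b)}"

definition lie_bracket :: "('n::finite) endo \<Rightarrow> 'n endo \<Rightarrow> 'n endo" where
  "lie_bracket X Y = (\<lambda>a. X (Y a) - Y (X a))"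

definition star :: "('n::finite) endo \<Rightarrow> 'n endo" where
  "star X = (\<lambda>a. hconj (X (hconj a)))"

definition lie_subalgebra_Der :: "('n::finite) endo set \<Rightarrow> bool" where
  "lie_subalgebra_Der g \<longleftrightarrow>
     g \<subseteq> Der \<and> (\<lambda>a. 0) \<in> g \<and>
     (\<forall>X\<in>g. \<forall>Y\<in>g. (\<lambda>a. X a + Y a) \<in> g) \<and>
     (\<forall>c. \<forall>X\<in>g. (\<lambda>a. cscale c (X a)) \<in> g) \<and>
     (\<forall>X\<in>g. \<forall>Y\<in>g. lie_bracket X Y \<in> g)"

definition real_derivations :: "('n::finite) endo set \<Rightarrow> 'n endo set" where
  "real_derivations g = {X \<in> g. star X = X}"

definition theta :: "('n::finite) endo \<Rightarrow> complex^'n^'n" where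
  "theta X = (THE T. trace T = 0 \<and> (\<forall>a. X a = T ** a - a ** T))"


section \<open>Hermitian connections and gauge transformations\<close>

text \<open>
  A connection on \<open>\<E>\<close> is indexed by \<open>X \<in> g\<close>; it is represented by a total function of \<open>X\<close> whose
  values outside \<open>g\<close> are irrelevant, and two connections are only ever compared on \<open>g\<close>.
\<close>

type_synonym ('n, 'm) conn = "'n endo \<Rightarrow> complex^'n^'m \<Rightarrow> complex^'n^'m"

definition connection :: "('n::finite) endo set \<Rightarrow> ('n, 'm::finite) conn \<Rightarrow> bool" where
  "connection g D \<longleftrightarrow>
     (\<forall>X\<in>g. clinear (D X)) \<and>
     (\<forall>X\<in>g. \<forall>Y\<in>g. \<forall>s. D (\<lambda>a. X a + Y a) s = D X s + D Y s) \<and>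
     (\<forall>c. \<forall>X\<in>g. \<forall>s. D (\<lambda>a. cscale c (X a)) s = cscale c (D X s)) \<and>
     (\<forall>X\<in>g. \<forall>s a. D X (s ** a) = D X s ** a + s ** X a)"

definition herm :: "complex^'n^'m \<Rightarrow> complex^'n^'m \<Rightarrow> complex^'n^'n" where
  "herm s t = hconj s ** t"

definition hermitian_connection :: "('n::finite) endo set \<Rightarrow> ('n, 'm::finite) conn \<Rightarrow> bool" where
  "hermitian_connection g D \<longleftrightarrow>
     connection g D \<and>
     (\<forall>X\<in>g. \<forall>s t. X (herm s t) = herm (D (star X) s) t + herm s (D X t))"

definition unitary_group :: "(complex^'m^'m) set" where
  "unitary_group = {u. u ** hconj u = mat 1 \<and> hconj u ** u = mat 1}"

definition gauge_transform :: "complex^'m^'m \<Rightarrow> ('n::finite, 'm::finite) conn \<Rightarrow> ('n, 'm) conn" where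
  "gauge_transform u D = (\<lambda>X s. u ** D X (hconj u ** s))"

definition gauge_equivalent :: "('n::finite) endo set \<Rightarrow> ('n, 'm::finite) conn \<Rightarrow> ('n, 'm) conn \<Rightarrow> bool" where
  "gauge_equivalent g D D' \<longleftrightarrow>
     (\<exists>u\<in>unitary_group. \<forall>X\<in>g. D' X = gauge_transform u D X)"


section \<open>Parallel transport and observables\<close>

text \<open>
  The exponential \<open>e\<^sup>f\<close> of a linear endomorphism \<open>f\<close>, as a pointwise convergent series (in finite
  dimension, the same as convergence in operator norm).
\<close>

definition endo_exp :: "('v \<Rightarrow> 'v) \<Rightarrow> 'v \<Rightarrow> 'v::real_normed_vector" where
  "endo_exp f v = (\<Sum>k. (1 / fact k) *\<^sub>R (f ^^ k) v)"

definition mat_exp :: "complex^'n^'n \<Rightarrow> complex^'n^'n" where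
  "mat_exp M = endo_exp (\<lambda>N. M ** N) (mat 1)"

definition transport :: "('n::finite, 'm::finite) conn \<Rightarrow> 'n endo \<Rightarrow> real \<Rightarrow> complex^'n^'m \<Rightarrow> complex^'n^'m"
  where "transport D X \<tau> = endo_exp (\<lambda>s. \<tau> *\<^sub>R D X s)"

definition linear_transport :: "('n::finite, 'm::finite) conn \<Rightarrow> 'n endo \<Rightarrow> real \<Rightarrow> complex^'n^'m \<Rightarrow> complex^'n^'m"
  where "linear_transport D X \<tau> = (\<lambda>s. transport D X \<tau> s ** mat_exp (\<tau> *\<^sub>R theta X))"

text \<open>The identification of the right \<open>A\<close>-linear endomorphisms of \<open>\<E>\<close> with \<open>M\<^sub>m(\<complex>)\<close>.\<close>

definition matrix_of_endo :: "(complex^'n^'m \<Rightarrow> complex^'n^'m) \<Rightarrow> complex^'m^'m" where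
  "matrix_of_endo F = (THE M. \<forall>s. F s = M ** s)"

definition wilson :: "('n::finite) endo list \<Rightarrow> ('n, 'm::finite) conn \<Rightarrow> complex" where
  "wilson Xs D = trace (matrix_of_endo (foldr (\<lambda>X F. linear_transport D X 1 \<circ> F) Xs id))"

definition observables :: "('n::finite) endo set \<Rightarrow> (('n, 'm::finite) conn \<Rightarrow> complex) set" where
  "observables g = {wilson Xs | Xs. set Xs \<subseteq> real_derivations g}"

end

theory Submission
  imports Defs
begin

text \<open>
  For real \<open>X\<close> the gauge potential \<open>B(X)\<close> is antihermitian, so the holonomies
  (products of exponentials of gauge potentials) of the two connections form families of matrices
  indexed by words, closed under products and adjoints, with equal traces.  Such families are
  unitarily equivalent: among the contractions intertwining them take \<open>u\<close> of maximal
  Hilbert-Schmidt norm.  With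
  \<open>h = 1 - u\<^sup>*u\<close>, \<open>h' = 1 - uu\<^sup>*\<close> and any intertwiner \<open>T\<close>, the perturbations \<open>u \<plusminus> \<epsilon> h'Th\<close> are again
  intertwining contractions, so \<open>h'Th = 0\<close> by maximality.  Taking the Casimir intertwiners
  \<open>T = \<Sum> e'\<^sub>i S e\<^sub>i\<^sup>*\<close>, where \<open>(e\<^sub>i, e'\<^sub>i)\<close> is an orthonormal basis of the real span of all pairs of
  corresponding matrices and \<open>S\<close> is arbitrary, gives \<open>\<Sum> \<bar>Tr(e\<^sub>ih)\<bar>\<^sup>2 = 0\<close>.  Hence \<open>Tr h = 0\<close> and
  \<open>h = 0\<close>, that is, \<open>u\<close> is unitary.  Differentiating \<open>u exp(t B(X)) = exp(t B'(X)) u\<close> at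
  \<open>t = 0\<close> gives \<open>u B(X) u\<^sup>* = B'(X)\<close> for real \<open>X\<close>, and complex linearity extends this to \<open>g\<close>.
\<close>

section \<open>Complex matrices\<close>

lemma bounded_bilinear_matrix_mult:
  "bounded_bilinear ((**) :: complex^'n^'m \<Rightarrow> complex^'p^'n \<Rightarrow> complex^'p^'m)"
  by (simp add: bilinear_conv_bounded_bilinear[symmetric] bilinear_def linear_iff
      matrix_matrix_mult_def vec_eq_iff sum.distrib scaleR_sum_right algebra_simps)

interpretation matmul: bounded_bilinear
  "(**) :: complex^'n^'m \<Rightarrow> complex^'p^'n \<Rightarrow> complex^'p^'m"
  by (rule bounded_bilinear_matrix_mult)

lemma linear_hconj: "linear (hconj :: complex^'n^'m \<Rightarrow> complex^'m^'n)"
  by (simp add: linear_iff hconj_def vec_eq_iff)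

lemmas hconj_diff = linear_diff[OF linear_hconj]
  and hconj_scaleR = linear_scale[OF linear_hconj]
  and hconj_sum = linear_sum[OF linear_hconj]

lemma hconj_hconj [simp]: "hconj (hconj M) = M"
  by (simp add: hconj_def vec_eq_iff)

lemma hconj_mult: "hconj (M ** N) = hconj N ** hconj M"
  by (simp add: hconj_def vec_eq_iff matrix_matrix_mult_def mult.commute)

lemma hconj_mat_1 [simp]: "hconj (mat 1) = mat 1"
  by (auto simp: hconj_def vec_eq_iff mat_def)

lemma trace_hconj: "trace (hconj M) = cnj (trace M)"
  by (simp add: hconj_def trace_def)

lemma linear_trace: "linear (trace :: complex^'n^'n \<Rightarrow> complex)"
  by (simp add: linear_iff trace_def sum.distrib scaleR_sum_right)

text \<open>This makes \<open>hconj\<close> the adjoint of multiplication for the real Euclidean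
  structure, so real orthonormal bases can be used on spaces of complex matrices.\<close>

lemma inner_matrix: "inner M N = Re (trace (hconj M ** N))"
  for M N :: "complex^'n^'m"
  unfolding inner_vec_def trace_def matrix_matrix_mult_def hconj_def
  by (subst sum.swap) (simp add: inner_complex_def)

lemma inner_matmul_left: "inner (A ** M) N = inner M (hconj A ** N)"
  for A :: "complex^'m^'k" and M :: "complex^'n^'m"
  by (simp add: inner_matrix hconj_mult matrix_mul_assoc)

section \<open>Matrix units and right-linear maps\<close>

definition matrix_unit :: "'m \<Rightarrow> 'n \<Rightarrow> complex^'n^'m" where
  "matrix_unit i j = (\<chi> k l. if k = i \<and> l = j then 1 else 0)"

lemma matmul_matrix_unit: "(M ** matrix_unit i j) $ p $ q = (if q = j then M $ p $ i else 0)"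
  by (simp add: matrix_matrix_mult_def matrix_unit_def if_distrib[of "\<lambda>z. _ * z"] cong: if_cong)

lemma matrix_unit_matmul: "(matrix_unit i j ** M) $ p $ q = (if p = i then M $ j $ q else 0)"
  by (simp add: matrix_matrix_mult_def matrix_unit_def if_distrib[of "\<lambda>z. z * _"] cong: if_cong)

text \<open>Multiplication by a matrix unit copies column \<open>i\<close> of \<open>M\<close> into
  one chosen column. Here \<open>undefined\<close> is just an arbitrary index, which exists because
  types are nonempty.\<close>

lemma matmul_eq_zero_imp:
  fixes M :: "complex^'m^'k"
  assumes "\<And>s :: complex^'n^'m. M ** s = 0"
  shows "M = 0"
proof -
  have "M $ p $ i = 0" for p i
    using arg_cong[OF assms[of "matrix_unit i undefined"], of "\<lambda>N. N $ p $ undefined"]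
    by (simp add: matmul_matrix_unit)
  then show ?thesis
    by (simp add: vec_eq_iff)
qed

lemma matmul_ext:
  fixes M N :: "complex^'m^'k"
  assumes "\<And>s :: complex^'n^'m. M ** s = N ** s"
  shows "M = N"
proof -
  have "(M - N) ** s = 0" for s :: "complex^'n^'m"
    by (simp add: assms matmul.diff_left)
  then have "M - N = 0"
    by (rule matmul_eq_zero_imp)
  then show ?thesis
    by simp
qed

lemma matrix_of_endo_eqI:
  fixes F :: "complex^'n^'m \<Rightarrow> complex^'n^'m"
  assumes "\<And>s. F s = M ** s"
  shows "matrix_of_endo F = M"
  unfolding matrix_of_endo_def using assms by (intro the_equality) (auto intro: matmul_ext)

text \<open>Every \<open>s\<close> is the sum of \<open>matrix_unit k undefined ** ?R k\<close>, so
  right linearity reduces \<open>F\<close> to its values on matrix units in one column. Complex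
  homogeneity is contained in right linearity, through scalar matrices.\<close>

lemma right_linear_imp_left_mult:
  fixes F :: "complex^'n^'m \<Rightarrow> complex^'n^'m"
  assumes add: "\<And>s t. F (s + t) = F s + F t"
    and mult: "\<And>s (a :: complex^'n^'n). F (s ** a) = F s ** a"
  shows "F s = matrix_of_endo F ** s"
proof -
  interpret additive F
    using add by unfold_locales
  define M :: "complex^'m^'m" where "M = (\<chi> p k. F (matrix_unit k undefined) $ p $ undefined)"
  have "F s = M ** s" for s
  proof -
    let ?R = "\<lambda>k. matrix_unit (undefined :: 'n) k ** s"
    have "s = (\<Sum>k\<in>UNIV. matrix_unit k undefined ** ?R k)"
      by (simp add: vec_eq_iff matrix_unit_matmul)
    then have "F s = (\<Sum>k\<in>UNIV. F (matrix_unit k undefined) ** ?R k)"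
      by (metis (no_types, lifting) mult sum sum.cong)
    moreover have "(F (matrix_unit k undefined) ** ?R k) $ p $ q = M $ p $ k * s $ k $ q" for k p q
      unfolding matrix_mul_assoc
      by (simp add: matrix_matrix_mult_def[of _ s] matmul_matrix_unit M_def if_distrib[of "\<lambda>z. z * _"] cong: if_cong)
    ultimately show ?thesis
      by (simp add: vec_eq_iff matrix_matrix_mult_def[of M])
  qed
  then show ?thesis
    by (simp add: matrix_of_endo_eqI[of F M])
qed

lemma cscale_of_real: "cscale (of_real r) M = r *\<^sub>R M"
  by (simp add: cscale_def vec_eq_iff scaleR_conv_of_real[where 'a = complex])

section \<open>Intertwining contractions\<close>

text \<open>
  The matrix norm is the Hilbert-Schmidt norm; left multiplication by \<open>u\<close> acts column by column, so
  this says that \<open>u\<close> has operator norm at most \<open>1\<close>.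
\<close>

definition contraction :: "complex^'m^'m \<Rightarrow> bool" where
  "contraction u \<longleftrightarrow> (\<forall>v :: complex^'m^'m. norm (u ** v) \<le> norm v)"

text \<open>For a contraction this is the square of the usual defect operator: it is positive and
  measures how far \<open>u\<close> is from being an isometry.\<close>

definition defect :: "complex^'m^'m \<Rightarrow> complex^'m^'m" where
  "defect u = mat 1 - hconj u ** u"

lemma hconj_defect: "hconj (defect u) = defect u"
  unfolding defect_def hconj_diff hconj_mult by simp

lemma mult_defect: "u ** defect u = defect (hconj u) ** u"
  by (simp add: defect_def matmul.diff_left matmul.diff_right matrix_mul_assoc)

lemma contraction_hconj:
  fixes u :: "complex^'m^'m"
  assumes "contraction u"
  shows "contraction (hconj u)"
  unfolding contraction_def
proof
  fix w :: "complex^'m^'m"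
  let ?x = "hconj u ** w"
  have "norm ?x * norm ?x = inner w (u ** ?x)"
    using inner_matmul_left[of "hconj u" w ?x] unfolding hconj_hconj dot_square_norm power2_eq_square .
  also have "\<dots> \<le> norm w * norm (u ** ?x)"
    by (rule norm_cauchy_schwarz)
  also have "\<dots> \<le> norm w * norm ?x"
    using assms by (auto simp: contraction_def intro!: mult_left_mono)
  finally show "norm ?x \<le> norm w"
    by (metis mult_right_le_imp_le norm_ge_zero norm_not_less_zero not_less order_le_less)
qed

lemma inner_defect: "inner (defect u ** v) v = (norm v)\<^sup>2 - (norm (u ** v))\<^sup>2"
  for v :: "complex^'n^'m"
proof -
  have "inner (hconj u ** (u ** v)) v = inner (u ** v) (u ** v)"
    by (simp add: inner_matmul_left)
  then show ?thesis
    by (simp add: defect_def matmul.diff_left inner_diff_left dot_square_norm flip: matrix_mul_assoc)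
qed

text \<open>With \<open>h = defect u\<close> this is \<open>h\<^sup>2 \<le> h\<close> for quadratic
  forms, true because \<open>0 \<le> h \<le> 1\<close>.\<close>

lemma norm_defect_le:
  fixes u v :: "complex^'m^'m"
  assumes "contraction u"
  shows "(norm (defect u ** v))\<^sup>2 \<le> inner (defect u ** v) v"
proof -
  let ?x = "hconj u ** (u ** v)"
  have d: "defect u ** v = v - ?x"
    by (simp add: defect_def matmul.diff_left flip: matrix_mul_assoc)
  have 1: "inner v ?x = (norm (u ** v))\<^sup>2"
    using inner_matmul_left[of u v "u ** v"] by (simp add: dot_square_norm)
  have "norm ?x \<le> norm (u ** v)"
    using contraction_hconj[OF assms] by (simp add: contraction_def)
  then have "inner ?x ?x \<le> inner v ?x"
    using 1 by (simp add: dot_square_norm power_mono)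
  then show ?thesis
    by (simp add: d dot_square_norm[symmetric] inner_diff_left inner_diff_right inner_commute)
qed

text \<open>Sandwiching \<open>T\<close> between the two defects makes the first- and second-order
  changes of \<open>(norm (u ** v))\<^sup>2\<close> both bounded by multiples of
  \<open>(norm (defect u ** v))\<^sup>2\<close>. The slack
  \<open>(norm v)\<^sup>2 - (norm (u ** v))\<^sup>2\<close> dominates that quantity, so small
  \<open>d\<close> of either sign are absorbed.\<close>

lemma contraction_perturb:
  fixes u T :: "complex^'m^'m"
  assumes "contraction u"
  shows "\<exists>e>0. \<forall>d. \<bar>d\<bar> \<le> e \<longrightarrow> contraction (u + d *\<^sub>R (defect (hconj u) ** T ** defect u))"
proof -
  let ?h = "defect u" and ?h' = "defect (hconj u)"
  obtain K where K: "0 < K" "\<And>(A :: complex^'m^'m) (B :: complex^'m^'m). norm (A ** B) \<le> norm A * norm B * K"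
    using matmul.pos_bounded by blast
  define C C' where "C = norm T * K" and "C' = norm (?h' ** T) * K"
  have C: "0 \<le> C" "0 \<le> C'" "\<And>x :: complex^'m^'m. norm (T ** x) \<le> C * norm x" "\<And>x :: complex^'m^'m. norm (?h' ** T ** x) \<le> C' * norm x"
    using K(1) K(2)[of T] K(2)[of "?h' ** T"] by (simp_all add: C_def C'_def mult_ac)
  \<comment> \<open>The summand \<open>1\<close> keeps the denominator at least \<open>1\<close>, so
    \<open>e \<le> 1\<close>, which later gives \<open>d\<^sup>2 \<le> e\<close>; the rest makes the
    total change at most \<open>(norm x)\<^sup>2\<close>.\<close>
  define e where "e = 1 / (2 * C + C'\<^sup>2 + 1)"
  have pos: "2 * C + C'\<^sup>2 + 1 > 0"
    using C(1) by (simp add: add_nonneg_pos)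
  have e: "0 < e" "e \<le> 1" "e * (2 * C + C'\<^sup>2) \<le> 1"
    using pos C(1) by (simp_all add: e_def)
  have "contraction (u + d *\<^sub>R (?h' ** T ** ?h))" if d: "\<bar>d\<bar> \<le> e" for d
    unfolding contraction_def
  proof
    fix v :: "complex^'m^'m"
    define x where "x = ?h ** v"
    have eq: "(u + d *\<^sub>R (?h' ** T ** ?h)) ** v = u ** v + d *\<^sub>R (?h' ** T ** x)"
      by (simp add: x_def matmul.add_left matmul.scaleR_left matrix_mul_assoc)
    \<comment> \<open>Moved onto \<open>u ** v\<close>, the self-adjoint \<open>?h'\<close> passes
      through \<open>u\<close> as \<open>?h\<close>, so both factors of the inner product are
      controlled by \<open>x\<close>.\<close>
    have "inner (u ** v) (?h' ** T ** x) = inner (?h' ** (u ** v)) (T ** x)"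
      by (simp add: inner_matmul_left[of ?h'] hconj_defect flip: matrix_mul_assoc)
    also have "?h' ** (u ** v) = u ** x"
      by (simp add: x_def mult_defect matrix_mul_assoc)
    finally have "\<bar>inner (u ** v) (?h' ** T ** x)\<bar> \<le> norm (u ** x) * norm (T ** x)"
      by (simp add: Cauchy_Schwarz_ineq2)
    also have "\<dots> \<le> norm x * (C * norm x)"
      using assms C by (intro mult_mono) (auto simp: contraction_def)
    finally have 1: "\<bar>inner (u ** v) (?h' ** T ** x)\<bar> \<le> C * (norm x)\<^sup>2"
      by (simp add: power2_eq_square mult_ac)
    have 2: "(norm (?h' ** T ** x))\<^sup>2 \<le> C'\<^sup>2 * (norm x)\<^sup>2"
      using C(4)[of x] by (metis norm_ge_zero power_mono power_mult_distrib)
    have 3: "(norm x)\<^sup>2 \<le> (norm v)\<^sup>2 - (norm (u ** v))\<^sup>2"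
      using norm_defect_le[OF assms, of v] by (simp add: x_def inner_defect)
    have "d * inner (u ** v) (?h' ** T ** x) \<le> \<bar>d\<bar> * \<bar>inner (u ** v) (?h' ** T ** x)\<bar>"
      by (simp flip: abs_mult)
    also have "\<dots> \<le> e * (C * (norm x)\<^sup>2)"
      using 1 d e(1) by (intro mult_mono) auto
    finally have 4: "d * inner (u ** v) (?h' ** T ** x) \<le> e * (C * (norm x)\<^sup>2)" .
    have "\<bar>d\<bar> * \<bar>d\<bar> \<le> e * 1"
      using d e by (intro mult_mono) auto
    then have "d\<^sup>2 \<le> e"
      by (simp add: power2_eq_square)
    then have 5: "d\<^sup>2 * (norm (?h' ** T ** x))\<^sup>2 \<le> e * (C'\<^sup>2 * (norm x)\<^sup>2)"
      using 2 e(1) by (intro mult_mono) auto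
    have "(norm (u ** v + d *\<^sub>R (?h' ** T ** x)))\<^sup>2
        = (norm (u ** v))\<^sup>2 + 2 * (d * inner (u ** v) (?h' ** T ** x)) + d\<^sup>2 * (norm (?h' ** T ** x))\<^sup>2"
      unfolding power2_norm_eq_inner
      by (simp add: inner_add_left inner_add_right inner_commute power2_eq_square algebra_simps)
    also have "\<dots> \<le> (norm (u ** v))\<^sup>2 + e * (2 * C + C'\<^sup>2) * (norm x)\<^sup>2"
      using 4 5 by (simp add: algebra_simps)
    also have "\<dots> \<le> (norm (u ** v))\<^sup>2 + 1 * (norm x)\<^sup>2"
      using e(3) by (intro add_left_mono mult_right_mono) auto
    also have "\<dots> \<le> (norm v)\<^sup>2"
      using 3 by simp
    finally show "norm ((u + d *\<^sub>R (?h' ** T ** ?h)) ** v) \<le> norm v"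
      unfolding eq by (rule power2_le_imp_le) simp
  qed
  with e(1) show ?thesis
    by blast
qed

section \<open>Existence of a maximal intertwining contraction\<close>

lemma compact_intertwining_contractions:
  "compact {u :: complex^'m^'m. contraction u \<and> (\<forall>(a, a')\<in>P. u ** a = a' ** u)}"
proof -
  \<comment> \<open>Testing the contraction property on \<open>mat 1\<close> bounds
    \<open>norm u\<close>.\<close>
  have "bounded {u :: complex^'m^'m. contraction u}"
    by (rule boundedI[of _ "norm (mat 1 :: complex^'m^'m)"])
       (metis contraction_def matrix_mul_rid mem_Collect_eq)
  moreover have "closed {u :: complex^'m^'m. contraction u \<and> (\<forall>x\<in>P. u ** fst x = snd x ** u)}"
    unfolding contraction_def Ball_def
    by (intro closed_Collect_conj closed_Collect_all closed_Collect_imp closed_Collect_le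
        closed_Collect_eq continuous_intros matmul.continuous_on) auto
  ultimately show ?thesis
    unfolding compact_eq_bounded_closed case_prod_beta
    by (metis (mono_tags, lifting) bounded_subset mem_Collect_eq subsetI)
qed

text \<open>The set is compact and contains \<open>0\<close>, so the norm attains its maximum. This
  norm is strictly convex, which later forces two-sided perturbations to vanish.\<close>

lemma intertwiner_maximal:
  obtains u :: "complex^'m^'m"
  where "contraction u" "\<forall>(a, a')\<in>P. u ** a = a' ** u"
    "\<forall>w. contraction w \<longrightarrow> (\<forall>(a, a')\<in>P. w ** a = a' ** w) \<longrightarrow> norm w \<le> norm u"
proof -
  let ?S = "{u :: complex^'m^'m. contraction u \<and> (\<forall>(a, a')\<in>P. u ** a = a' ** u)}"
  have "0 \<in> ?S"
    by (auto simp: contraction_def matmul.zero_left matmul.zero_right)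
  then have "?S \<noteq> {}"
    by blast
  from continuous_attains_sup[OF compact_intertwining_contractions this, of norm]
  obtain u where "u \<in> ?S" "\<forall>w\<in>?S. norm w \<le> norm u"
    using continuous_on_norm_id by blast
  then show ?thesis
    by (intro that[of u]) auto
qed

section \<open>Trace functions determine unitary equivalence\<close>

lemma subspace_orthonormal_expansion:
  fixes W :: "'v::euclidean_space set"
  assumes "subspace W"
  obtains E where "finite E" "E \<subseteq> W" "\<forall>x\<in>W. (\<Sum>e\<in>E. (x \<bullet> e) *\<^sub>R e) = x"
proof -
  from orthonormal_basis_subspace[OF assms]
  obtain B where B: "B \<subseteq> W" "pairwise orthogonal B" "\<And>x. x \<in> B \<Longrightarrow> norm x = 1"
    "independent B" "span B = W"
    by metis
  have "finite B"
    using B(4) by (rule independent_imp_finite)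
  then show ?thesis
    using that[of B] B orthonormal_basis_expand[OF B(2,3)] by simp
qed

text \<open>Inserting \<open>S = matrix_unit p q\<close> and reading off entry \<open>(p, q)\<close>
  isolates the products of diagonal entries; summing over \<open>p\<close> and \<open>q\<close>
  produces the traces. This turns an identity in an arbitrary \<open>S\<close> into a scalar
  one.\<close>

lemma sum_trace_mult_zero:
  fixes x y :: "'i \<Rightarrow> complex^'m^'m"
  assumes "\<And>S :: complex^'m^'m. (\<Sum>i\<in>I. x i ** S ** y i) = 0"
  shows "(\<Sum>i\<in>I. trace (x i) * trace (y i)) = 0"
proof -
  have *: "(\<Sum>i\<in>I. x i $ p $ p * y i $ q $ q) = 0" for p q
  proof -
    have "(x i ** matrix_unit p q ** y i) $ p $ q = x i $ p $ p * y i $ q $ q" for i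
      by (simp add: matrix_matrix_mult_def[of "x i ** matrix_unit p q"] matmul_matrix_unit
          if_distrib[of "\<lambda>z. z * _"] cong: if_cong)
    then show ?thesis
      using arg_cong[OF assms[of "matrix_unit p q"], of "\<lambda>M. M $ p $ q"] by simp
  qed
  have "(\<Sum>i\<in>I. trace (x i) * trace (y i)) = (\<Sum>i\<in>I. \<Sum>p\<in>UNIV. \<Sum>q\<in>UNIV. x i $ p $ p * y i $ q $ q)"
    by (simp add: trace_def sum_product)
  also have "\<dots> = (\<Sum>p\<in>UNIV. \<Sum>q\<in>UNIV. \<Sum>i\<in>I. x i $ p $ p * y i $ q $ q)"
    by (subst sum.swap, rule sum.cong, simp, rule sum.swap)
  finally show ?thesis
    by (simp add: *)
qed

lemma span_closed_under_linear:
  assumes "linear f" "f ` S \<subseteq> span S" "x \<in> span S"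
  shows "f x \<in> span S"
  using assms by (metis image_eqI linear_span_image span_mono span_span subsetD)

text \<open>Left multiplication by a pair of \<open>P\<close> preserves the real span of
  \<open>P\<close>, and its coefficients with respect to \<open>E\<close> are the transpose of those
  for the adjoint pair. Exchanging the order of summation therefore trades \<open>b'\<close> on the
  left for \<open>b\<close> on the right.\<close>

lemma casimir_intertwines:
  fixes P :: "((complex^'m^'m) \<times> (complex^'m^'m)) set"
  assumes mult: "\<And>a a' b b'. (a, a') \<in> P \<Longrightarrow> (b, b') \<in> P \<Longrightarrow> (a ** b, a' ** b') \<in> P"
    and conj: "\<And>a a'. (a, a') \<in> P \<Longrightarrow> (hconj a, hconj a') \<in> P"
    and E: "E \<subseteq> span P" "\<forall>x\<in>span P. (\<Sum>e\<in>E. (x \<bullet> e) *\<^sub>R e) = x"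
    and b: "(b, b') \<in> P"
  shows "(\<Sum>e\<in>E. snd e ** S ** hconj (fst e)) ** b = b' ** (\<Sum>e\<in>E. snd e ** S ** hconj (fst e))"
proof -
  define L where "L c x = (fst c ** fst x, snd c ** snd x)"
    for c x :: "(complex^'m^'m) \<times> (complex^'m^'m)"
  have "linear (L c)" for c
    by (simp add: L_def linear_iff matmul.add_right matmul.scaleR_right)
  moreover have "L c ` P \<subseteq> span P" if "c \<in> P" for c
    using that mult by (auto simp: L_def intro!: span_base)
  ultimately have LW: "L c x \<in> span P" if "c \<in> P" "x \<in> span P" for c x
    using that by (blast intro: span_closed_under_linear)
  have fst_L: "fst c ** fst x = (\<Sum>e\<in>E. (L c x \<bullet> e) *\<^sub>R fst e)"
    and snd_L: "snd c ** snd x = (\<Sum>e\<in>E. (L c x \<bullet> e) *\<^sub>R snd e)"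
    if "c \<in> P" "x \<in> span P" for c x
    using arg_cong[OF bspec[OF E(2) LW[OF that]], of fst] arg_cong[OF bspec[OF E(2) LW[OF that]], of snd]
    by (simp_all add: L_def fst_sum snd_sum)
  define B where "B = (hconj b, hconj b')"
  have adj: "L (b, b') e \<bullet> f = L B f \<bullet> e" for e f
    unfolding L_def B_def inner_prod_def fst_conv snd_conv inner_matmul_left[of b] inner_matmul_left[of b']
    by (simp only: inner_commute)
  have "b' ** (\<Sum>e\<in>E. snd e ** S ** hconj (fst e)) = (\<Sum>e\<in>E. (b' ** snd e) ** S ** hconj (fst e))"
    by (simp add: matmul.sum_right matrix_mul_assoc)
  also have "\<dots> = (\<Sum>e\<in>E. (\<Sum>f\<in>E. (L (b, b') e \<bullet> f) *\<^sub>R snd f) ** S ** hconj (fst e))"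
    using snd_L[OF b] E(1) by (intro sum.cong) auto
  also have "\<dots> = (\<Sum>e\<in>E. \<Sum>f\<in>E. (L B f \<bullet> e) *\<^sub>R (snd f ** S ** hconj (fst e)))"
    by (simp add: adj matmul.sum_left matmul.scaleR_left)
  \<comment> \<open>For fixed \<open>f\<close>, the sum over \<open>e\<close> is now the first
    component of the expansion of \<open>L B f\<close>.\<close>
  also have "\<dots> = (\<Sum>f\<in>E. snd f ** S ** hconj (\<Sum>e\<in>E. (L B f \<bullet> e) *\<^sub>R fst e))"
    by (subst sum.swap) (simp add: matmul.sum_right matmul.scaleR_right hconj_sum hconj_scaleR)
  also have "\<dots> = (\<Sum>f\<in>E. snd f ** S ** hconj (hconj b ** fst f))"
  proof (intro sum.cong refl)
    fix f assume "f \<in> E"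
    then have "hconj b ** fst f = (\<Sum>e\<in>E. (L B f \<bullet> e) *\<^sub>R fst e)"
      using fst_L[of B f] conj[OF b] E(1) by (auto simp: B_def)
    then show "snd f ** S ** hconj (\<Sum>e\<in>E. (L B f \<bullet> e) *\<^sub>R fst e) = snd f ** S ** hconj (hconj b ** fst f)"
      by simp
  qed
  also have "\<dots> = (\<Sum>e\<in>E. snd e ** S ** hconj (fst e)) ** b"
    by (simp add: hconj_mult matmul.sum_left matrix_mul_assoc)
  finally show ?thesis ..
qed

text \<open>A form of Specht's theorem. The trace hypothesis enters through \<open>tr\<close>, which
  equates traces against the defects on the two sides; the unit of \<open>P\<close> enters at the
  end, to recover \<open>trace ?h\<close>.\<close>

lemma unitary_equivalence_if_trace_eq:
  fixes P :: "((complex^'m^'m) \<times> (complex^'m^'m)) set"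
  assumes one: "(mat 1, mat 1) \<in> P"
    and mult: "\<And>a a' b b'. (a, a') \<in> P \<Longrightarrow> (b, b') \<in> P \<Longrightarrow> (a ** b, a' ** b') \<in> P"
    and conj: "\<And>a a'. (a, a') \<in> P \<Longrightarrow> (hconj a, hconj a') \<in> P"
    and trace: "\<And>a a'. (a, a') \<in> P \<Longrightarrow> trace a = trace a'"
  shows "\<exists>u\<in>unitary_group. \<forall>(a, a')\<in>P. u ** a = a' ** u"
proof -
  obtain u where contr: "contraction u" and u: "\<forall>(a, a')\<in>P. u ** a = a' ** u"
    and max: "\<forall>w. contraction w \<longrightarrow> (\<forall>(a, a')\<in>P. w ** a = a' ** w) \<longrightarrow> norm w \<le> norm u"
    by (rule intertwiner_maximal[of P])
  have tw: "u ** a = a' ** u" if "(a, a') \<in> P" for a a'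
    using u that by blast
  have maximal: "norm w \<le> norm u"
    if "contraction w" "\<And>a a'. (a, a') \<in> P \<Longrightarrow> w ** a = a' ** w" for w
    using max that by blast
  let ?h = "defect u" and ?h' = "defect (hconj u)"
  have tw_hconj: "a ** hconj u = hconj u ** a'" if "(a, a') \<in> P" for a a'
    using arg_cong[OF tw[OF conj[OF that]], of hconj] by (simp add: hconj_mult)
  \<comment> \<open>\<open>u\<close> carries the first family to the second and
    \<open>hconj u\<close> carries it back, so \<open>hconj u ** u\<close> lies in the commutant of
    the first family.\<close>
  have comm: "?h ** a = a ** ?h" if "(a, a') \<in> P" for a a'
  proof -
    have "hconj u ** u ** a = hconj u ** a' ** u"
      by (simp add: tw[OF that] flip: matrix_mul_assoc)
    also have "\<dots> = a ** (hconj u ** u)"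
      by (simp add: tw_hconj[OF that] matrix_mul_assoc)
    finally have "hconj u ** u ** a = a ** (hconj u ** u)" .
    then show ?thesis
      by (simp add: defect_def matmul.diff_left matmul.diff_right)
  qed
  have comm': "?h' ** a' = a' ** ?h'" if "(a, a') \<in> P" for a a'
  proof -
    have "u ** hconj u ** a' = u ** a ** hconj u"
      by (simp add: tw_hconj[OF that] flip: matrix_mul_assoc)
    also have "\<dots> = a' ** (u ** hconj u)"
      by (simp add: tw[OF that] matrix_mul_assoc)
    finally have "u ** hconj u ** a' = a' ** (u ** hconj u)" .
    then show ?thesis
      by (simp add: defect_def matmul.diff_left matmul.diff_right)
  qed
  have tr: "trace (a ** ?h) = trace (a' ** ?h')" if "(a, a') \<in> P" for a a'
  proof -
    \<comment> \<open>Cyclicity of the trace matches the parts containing \<open>u\<close>; what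
      remains is \<open>trace a = trace a'\<close>.\<close>
    have "trace (a ** (hconj u ** u)) = trace (hconj u ** (a' ** u))"
      using tw_hconj[OF that] by (simp add: matrix_mul_assoc)
    also have "\<dots> = trace (a' ** (u ** hconj u))"
      by (subst trace_mul_sym) (simp add: matrix_mul_assoc)
    finally show ?thesis
      using trace[OF that] by (simp add: defect_def matmul.diff_right trace_sub)
  qed
  obtain E where E: "finite E" "E \<subseteq> span P" "\<forall>x\<in>span P. (\<Sum>e\<in>E. (x \<bullet> e) *\<^sub>R e) = x"
    by (rule subspace_orthonormal_expansion[OF subspace_span[of P]])
  have comm'_E: "?h' ** snd e = snd e ** ?h'" and comm_E: "?h ** fst e = fst e ** ?h"
    and tr_E: "trace (fst e ** ?h) = trace (snd e ** ?h')" if "e \<in> E" for e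
  proof -
    \<comment> \<open>All three conditions are real-linear in the pair, so they pass from
      \<open>P\<close> to its span and hold on \<open>E\<close>.\<close>
    let ?Q = "{x. ?h' ** snd x = snd x ** ?h' \<and> ?h ** fst x = fst x ** ?h
        \<and> trace (fst x ** ?h) = trace (snd x ** ?h')}"
    have "subspace ?Q"
      by (auto simp: trace_add linear_scale[OF linear_trace] subspace_def matmul.add_left matmul.add_right matmul.scaleR_left matmul.scaleR_right
          matmul.zero_left matmul.zero_right)
    moreover have "P \<subseteq> ?Q"
      using comm comm' tr by auto
    ultimately have "e \<in> ?Q"
      using that E(2) span_minimal by blast
    then show "?h' ** snd e = snd e ** ?h'" "?h ** fst e = fst e ** ?h" "trace (fst e ** ?h) = trace (snd e ** ?h')"
      by auto
  qed
  have vanish: "?h' ** T ** ?h = 0" if T: "\<And>a a'. (a, a') \<in> P \<Longrightarrow> T ** a = a' ** T" for T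
  proof -
    let ?Z = "?h' ** T ** ?h"
    obtain e where e: "e > 0" "\<And>d. \<bar>d\<bar> \<le> e \<Longrightarrow> contraction (u + d *\<^sub>R ?Z)"
      using contraction_perturb[OF contr, of T] by blast
    have Z: "?Z ** a = a' ** ?Z" if "(a, a') \<in> P" for a a'
    proof -
      have "?Z ** a = ?h' ** (T ** a) ** ?h"
        by (simp add: comm[OF that] flip: matrix_mul_assoc)
      also have "\<dots> = (?h' ** a') ** T ** ?h"
        by (simp add: T[OF that] matrix_mul_assoc)
      also have "\<dots> = a' ** ?Z"
        by (simp add: comm'[OF that] matrix_mul_assoc)
      finally show ?thesis .
    qed
    have le: "norm (u + d *\<^sub>R ?Z) \<le> norm u" if "\<bar>d\<bar> \<le> e" for d
      using e(2)[OF that] Z tw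
      by (intro maximal) (auto simp: matmul.add_left matmul.add_right matmul.scaleR_left matmul.scaleR_right)
    \<comment> \<open>By the parallelogram law the left side is
      \<open>2 * (norm u)\<^sup>2 + 2 * e\<^sup>2 * (norm ?Z)\<^sup>2\<close>, so maximality in both
      directions forces \<open>?Z = 0\<close>.\<close>
    have "(norm (u + e *\<^sub>R ?Z))\<^sup>2 + (norm (u + (- e) *\<^sub>R ?Z))\<^sup>2 \<le> (norm u)\<^sup>2 + (norm u)\<^sup>2"
      using e(1) by (intro add_mono power_mono le) auto
    then have "e\<^sup>2 * (norm ?Z)\<^sup>2 \<le> 0"
      unfolding power2_norm_eq_inner
      by (simp add: inner_add_left inner_add_right inner_diff_left inner_diff_right inner_commute power2_eq_square)
    with e(1) show ?thesis
      by (simp add: mult_le_0_iff)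
  qed
  \<comment> \<open>The defects commute with the components of \<open>E\<close>, so they can be
    moved inward past them before traces are taken.\<close>
  have "(\<Sum>e\<in>E. (snd e ** ?h') ** S ** (?h ** hconj (fst e))) = 0" for S
  proof -
    have "?h' ** (\<Sum>e\<in>E. snd e ** S ** hconj (fst e)) ** ?h = 0"
      using casimir_intertwines[OF mult conj E(2,3)] by (rule vanish)
    moreover have "?h' ** snd e ** S ** (hconj (fst e) ** ?h) = snd e ** ?h' ** S ** (?h ** hconj (fst e))"
      if "e \<in> E" for e
      using comm'_E[OF that] arg_cong[OF comm_E[OF that], of hconj] by (simp add: hconj_mult hconj_defect)
    ultimately show ?thesis
      by (simp add: matmul.sum_left matmul.sum_right matrix_mul_assoc)
  qed
  then have "(\<Sum>e\<in>E. trace (snd e ** ?h') * trace (?h ** hconj (fst e))) = 0"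
    by (rule sum_trace_mult_zero)
  moreover have "trace (?h ** hconj (fst e)) = cnj (trace (fst e ** ?h))"
    for e :: "(complex^'m^'m) \<times> (complex^'m^'m)"
    by (simp add: hconj_mult hconj_defect flip: trace_hconj)
  \<comment> \<open>By \<open>tr_E\<close> the two factors are complex conjugates of each
    other.\<close>
  ultimately have "(\<Sum>e\<in>E. complex_of_real ((cmod (trace (fst e ** ?h)))\<^sup>2)) = 0"
    unfolding complex_norm_square by (simp add: tr_E[symmetric])
  then have "(\<Sum>e\<in>E. (cmod (trace (fst e ** ?h)))\<^sup>2) = 0"
    by (simp flip: of_real_power of_real_sum)
  then have tr0: "trace (fst e ** ?h) = 0" if "e \<in> E" for e
    using that E(1) by (simp add: sum_nonneg_eq_0_iff)
  \<comment> \<open>The identity lies in the span, so \<open>?h\<close> is a combination of the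
    \<open>fst e ** ?h\<close>, all of trace zero.\<close>
  have "mat 1 = (\<Sum>e\<in>E. ((mat 1, mat 1) \<bullet> e) *\<^sub>R fst e)"
    using arg_cong[OF bspec[OF E(3) span_base[OF one]], of fst] by (simp add: fst_sum)
  then have "?h = (\<Sum>e\<in>E. ((mat 1, mat 1) \<bullet> e) *\<^sub>R (fst e ** ?h))"
    by (metis (no_types, lifting) matmul.scaleR_left matmul.sum_left matrix_mul_lid sum.cong)
  then have "trace ?h = (\<Sum>e\<in>E. ((mat 1, mat 1) \<bullet> e) *\<^sub>R trace (fst e ** ?h))"
    by (metis (no_types, lifting) linear_scale[OF linear_trace] linear_sum[OF linear_trace] sum.cong)
  then have "trace ?h = 0"
    by (simp add: tr0)
  \<comment> \<open>At \<open>mat 1\<close>, \<open>norm_defect_le\<close> reads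
    \<open>(norm ?h)\<^sup>2 \<le> Re (trace ?h)\<close>.\<close>
  then have "(norm ?h)\<^sup>2 \<le> 0"
    using norm_defect_le[OF contr, of "mat 1"] by (simp add: inner_matrix hconj_defect)
  then have "?h = 0"
    by simp
  then have "hconj u ** u = mat 1"
    by (simp add: defect_def)
  then have "u \<in> unitary_group"
    by (simp add: unitary_group_def matrix_left_right_inverse)
  with tw show ?thesis
    by blast
qed

section \<open>Exponentials of linear endomorphisms\<close>

text \<open>
  A copy of the bounded endomorphisms as a Banach algebra, so that the library exponential applies;
  the type constructor of bounded linear functions itself cannot be an instance, since it has two
  type arguments.
\<close>

typedef (overloaded) 'v linop = "UNIV :: ('v::euclidean_space \<Rightarrow>\<^sub>L 'v) set"
  by blast

setup_lifting type_definition_linop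

instantiation linop :: (euclidean_space) real_normed_algebra_1
begin

lift_definition zero_linop :: "'a linop" is 0 .
lift_definition one_linop :: "'a linop" is id_blinfun .
lift_definition plus_linop :: "'a linop \<Rightarrow> 'a linop \<Rightarrow> 'a linop" is "(+)" .
lift_definition minus_linop :: "'a linop \<Rightarrow> 'a linop \<Rightarrow> 'a linop" is "(-)" .
lift_definition uminus_linop :: "'a linop \<Rightarrow> 'a linop" is uminus .
lift_definition times_linop :: "'a linop \<Rightarrow> 'a linop \<Rightarrow> 'a linop" is "(o\<^sub>L)" .
lift_definition scaleR_linop :: "real \<Rightarrow> 'a linop \<Rightarrow> 'a linop" is scaleR .
lift_definition norm_linop :: "'a linop \<Rightarrow> real" is norm .
lift_definition dist_linop :: "'a linop \<Rightarrow> 'a linop \<Rightarrow> real" is dist .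
lift_definition sgn_linop :: "'a linop \<Rightarrow> 'a linop" is sgn .

definition uniformity_linop :: "('a linop \<times> 'a linop) filter"
  where "uniformity_linop = (INF e\<in>{0 <..}. principal {(x, y). dist x y < e})"

definition open_linop :: "'a linop set \<Rightarrow> bool"
  where "open_linop S = (\<forall>x\<in>S. \<forall>\<^sub>F (x', y) in uniformity. x' = x \<longrightarrow> y \<in> S)"

instance
proof
  fix x y z :: "'a linop"
  show "x * y * z = x * (y * z)" "1 * x = x" "x * 1 = x"
    by (transfer; simp add: blinfun_eqI)+
  show "(x + y) * z = x * z + y * z" "x * (y + z) = x * y + x * z"
    by (transfer; simp add: blinfun_eqI blinfun.bilinear_simps)+
  show "(a *\<^sub>R x) * y = a *\<^sub>R (x * y)" "x * (a *\<^sub>R y) = a *\<^sub>R (x * y)" for a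
    by (transfer; simp add: blinfun_eqI blinfun.bilinear_simps)+
  show "(0 :: 'a linop) \<noteq> 1"
    by transfer (metis norm_blinfun_id norm_zero zero_neq_one)
  show "norm (x * y) \<le> norm x * norm y"
    by transfer (rule norm_blinfun_compose)
  show "norm (x + y) \<le> norm x + norm y"
    by transfer (rule norm_triangle_ineq)
  show "sgn x = inverse (norm x) *\<^sub>R x"
    by transfer (rule sgn_div_norm)
  show "dist x y = norm (x - y)"
    by transfer (rule dist_norm)
  show "x + y + z = x + (y + z)" "x + y = y + x" "x - y = x + - y"
    by (transfer; simp add: add_ac)+
  show "a *\<^sub>R (x + y) = a *\<^sub>R x + a *\<^sub>R y" "(a + b) *\<^sub>R x = a *\<^sub>R x + b *\<^sub>R x" for a b
    by (transfer; simp add: algebra_simps)+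
  show "0 + x = x" "- x + x = 0" "1 *\<^sub>R x = x"
    by (transfer; simp)+
  show "a *\<^sub>R b *\<^sub>R x = (a * b) *\<^sub>R x" for a b
    by transfer simp
  show "norm x = 0 \<longleftrightarrow> x = 0"
    by transfer simp
  show "norm (a *\<^sub>R x) = \<bar>a\<bar> * norm x" for a
    by transfer simp
  show "norm (1 :: 'a linop) = 1"
    by transfer simp
qed (rule uniformity_linop_def open_linop_def)+

end

instance linop :: (euclidean_space) banach
proof
  fix X :: "nat \<Rightarrow> 'a linop"
  assume "Cauchy X"
  then have "Cauchy (\<lambda>n. Rep_linop (X n))"
    by (simp add: Cauchy_def dist_linop.rep_eq)
  then obtain L where "(\<lambda>n. Rep_linop (X n)) \<longlonglongrightarrow> L"
    using Cauchy_convergent convergent_def by blast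
  then have "X \<longlonglongrightarrow> Abs_linop L"
    by (simp add: lim_sequentially dist_linop.rep_eq Abs_linop_inverse)
  then show "convergent X"
    by (rule convergentI)
qed

lift_definition linop_apply :: "'v linop \<Rightarrow> 'v::euclidean_space \<Rightarrow> 'v" is blinfun_apply .

lift_definition linop_of :: "('v::euclidean_space \<Rightarrow> 'v) \<Rightarrow> 'v linop" is Blinfun .

lemma linop_apply_linop_of [simp]: "linear f \<Longrightarrow> linop_apply (linop_of f) v = f v"
  by transfer (simp add: bounded_linear_Blinfun_apply linear_conv_bounded_linear)

lemma linop_eqI: "(\<And>v. linop_apply F v = linop_apply G v) \<Longrightarrow> F = G"
  by transfer (rule blinfun_eqI)

lemma linop_apply_simps [simp]:
  "linop_apply (F + G) v = linop_apply F v + linop_apply G v"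
  "linop_apply (F * G) v = linop_apply F (linop_apply G v)"
  "linop_apply (r *\<^sub>R F) v = r *\<^sub>R linop_apply F v"
  "linop_apply 1 v = v"
  by (transfer; simp add: blinfun.bilinear_simps)+

lemma bounded_linear_linop_apply: "bounded_linear (\<lambda>F. linop_apply F v)"
proof (rule bounded_linear_intro)
  show "norm (linop_apply F v) \<le> norm F * norm v" for F
    by transfer (rule norm_blinfun)
qed simp_all

lemma linop_apply_power: "linear f \<Longrightarrow> linop_apply (linop_of f ^ k) v = (f ^^ k) v"
  by (induction k) simp_all

text \<open>Evaluation at \<open>v\<close> is bounded and linear, so it turns the norm-convergent
  exponential series into the pointwise one defining \<open>endo_exp\<close>.\<close>

lemma endo_exp_sums_linop:
  assumes "linear f"
  shows "(\<lambda>k. (1 / fact k) *\<^sub>R (f ^^ k) v) sums linop_apply (exp (linop_of f)) v"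
  using bounded_linear.sums[OF bounded_linear_linop_apply exp_converges[of "linop_of f"], of v]
  by (simp add: linop_apply_power[OF assms] inverse_eq_divide)

lemma endo_exp_eq_linop: "linear f \<Longrightarrow> endo_exp f v = linop_apply (exp (linop_of f)) v"
  unfolding endo_exp_def by (rule sums_unique[symmetric, OF endo_exp_sums_linop])

lemma endo_exp_add:
  fixes f g :: "'v::euclidean_space \<Rightarrow> 'v"
  assumes f: "linear f" and g: "linear g" and comm: "\<And>v. f (g v) = g (f v)"
  shows "endo_exp (\<lambda>v. f v + g v) v = endo_exp f (endo_exp g v)"
proof -
  have fg: "linear (\<lambda>v. f v + g v)"
    using f g by (rule linear_compose_add)
  have sum: "linop_of (\<lambda>v. f v + g v) = linop_of f + linop_of g"
    by (rule linop_eqI) (simp add: f g fg)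
  have "linop_of f * linop_of g = linop_of g * linop_of f"
    by (rule linop_eqI) (simp add: f g, rule comm)
  then show ?thesis
    unfolding endo_exp_eq_linop[OF f] endo_exp_eq_linop[OF g] endo_exp_eq_linop[OF fg] sum
    by (metis exp_add_commuting linop_apply_simps(2))
qed

text \<open>The map \<open>h\<close> passes through the series term by term. Taking \<open>h\<close>
  to be multiplication by a fixed matrix or \<open>hconj\<close> yields the matrix exponential
  identities below.\<close>

lemma endo_exp_natural:
  fixes f :: "'v::euclidean_space \<Rightarrow> 'v" and g :: "'w::euclidean_space \<Rightarrow> 'w"
  assumes "linear f" "linear h" "\<And>v. h (f v) = g (h v)"
  shows "h (endo_exp f v) = endo_exp g (h v)"
proof -
  have "h ((f ^^ k) v) = (g ^^ k) (h v)" for k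
    by (induction k) (simp_all add: assms(3))
  then have "(\<lambda>k. (1 / fact k) *\<^sub>R (g ^^ k) (h v)) sums h (endo_exp f v)"
    using bounded_linear.sums[OF _ endo_exp_sums_linop[OF assms(1)], of h v] assms(1,2)
    by (simp add: linear_conv_bounded_linear linear_scale[OF assms(2)] endo_exp_eq_linop)
  then show ?thesis
    unfolding endo_exp_def[of g] by (rule sums_unique)
qed

lemma endo_exp_scaleR_has_vector_derivative:
  fixes f :: "'v::euclidean_space \<Rightarrow> 'v"
  assumes "linear f"
  shows "((\<lambda>t. endo_exp (\<lambda>v. t *\<^sub>R f v) v) has_vector_derivative f v) (at 0)"
proof -
  have lin: "linear (\<lambda>v. t *\<^sub>R f v)" for t
    using assms by (rule linear_compose_scale_right)
  have "linop_of (\<lambda>v. t *\<^sub>R f v) = t *\<^sub>R linop_of f" for t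
    using assms lin by (intro linop_eqI) simp
  then have "endo_exp (\<lambda>v. t *\<^sub>R f v) v = linop_apply (exp (t *\<^sub>R linop_of f)) v" for t
    by (simp add: endo_exp_eq_linop[OF lin])
  moreover have "((\<lambda>t. linop_apply (exp (t *\<^sub>R linop_of f)) v) has_vector_derivative
      linop_apply (exp (0 *\<^sub>R linop_of f) * linop_of f) v) (at 0)"
    by (intro bounded_linear.has_vector_derivative[OF bounded_linear_linop_apply]
        exp_scaleR_has_vector_derivative_right)
  ultimately show ?thesis
    using assms by simp
qed

section \<open>Matrix exponentials\<close>

lemma mat_exp_eq_right: "mat_exp M = endo_exp (\<lambda>N. N ** M) (mat 1)"
proof -
  \<comment> \<open>The second conjunct, that \<open>M\<close> commutes with its powers, strengthens
    the induction.\<close>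
  have "((\<lambda>N. M ** N) ^^ k) (mat 1) = ((\<lambda>N. N ** M) ^^ k) (mat 1)
      \<and> M ** ((\<lambda>N. N ** M) ^^ k) (mat 1) = ((\<lambda>N. N ** M) ^^ k) (mat 1) ** M" for k
    by (induction k) (simp_all add: matrix_mul_assoc)
  then show ?thesis
    by (simp add: mat_exp_def endo_exp_def)
qed

lemma linear_matmul_left: "linear (\<lambda>N :: complex^'n^'m. M ** N)"
  by (simp add: linear_iff matmul.add_right matmul.scaleR_right)

lemma linear_matmul_right: "linear (\<lambda>N :: complex^'n^'m. N ** M)"
  by (simp add: linear_iff matmul.add_left matmul.scaleR_left)

lemma mat_exp_mult: "mat_exp M ** s = endo_exp (\<lambda>x. M ** x) s"
  for s :: "complex^'n^'m"
  unfolding mat_exp_def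
  using endo_exp_natural[of "(**) M" "\<lambda>N. N ** s" "(**) M" "mat 1"]
  by (simp add: linear_matmul_left linear_matmul_right matrix_mul_assoc)

lemma mult_mat_exp: "s ** mat_exp M = endo_exp (\<lambda>x. x ** M) s"
  for s :: "complex^'n^'m"
  unfolding mat_exp_eq_right
  using endo_exp_natural[of "\<lambda>x. x ** M" "(**) s" "\<lambda>x. x ** M" "mat 1"]
  by (simp add: linear_matmul_left linear_matmul_right matrix_mul_assoc)

lemma hconj_mat_exp: "hconj (mat_exp M) = mat_exp (hconj M)"
  unfolding mat_exp_def[of M] mat_exp_eq_right[of "hconj M"]
  using endo_exp_natural[of "(**) M" hconj "\<lambda>x. x ** hconj M" "mat 1"]
  by (simp add: linear_matmul_left linear_hconj hconj_mult)

lemma mat_exp_has_vector_derivative: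
  "((\<lambda>t. mat_exp (t *\<^sub>R M)) has_vector_derivative M) (at 0)"
  using endo_exp_scaleR_has_vector_derivative[of "(**) M" "mat 1"]
  by (simp add: mat_exp_def linear_matmul_left matmul.scaleR_left)

lemma mat_exp_intertwines:
  assumes "\<And>t. u ** mat_exp (t *\<^sub>R M) = mat_exp (t *\<^sub>R N) ** u"
  shows "u ** M = N ** u"
proof -
  have "((\<lambda>t. u ** mat_exp (t *\<^sub>R M)) has_vector_derivative u ** M) (at 0)"
    by (rule bounded_linear.has_vector_derivative[OF matmul.bounded_linear_right mat_exp_has_vector_derivative])
  moreover have "((\<lambda>t. mat_exp (t *\<^sub>R N) ** u) has_vector_derivative N ** u) (at 0)"
    by (rule bounded_linear.has_vector_derivative[OF matmul.bounded_linear_left mat_exp_has_vector_derivative])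
  ultimately show ?thesis
    unfolding assms by (rule vector_derivative_unique_at)
qed

section \<open>Derivations of the matrix algebra are inner\<close>

text \<open>Commuting with the matrix units forces \<open>T\<close> to be scalar, and a scalar
  matrix of trace zero vanishes.\<close>

lemma commuting_traceless_eq_zero:
  fixes T :: "complex^'n^'n"
  assumes comm: "\<And>a. T ** a = a ** T" and tr: "trace T = 0"
  shows "T = 0"
proof -
  have *: "T $ k $ p = (if k = p then T $ q $ q else 0)" for k p q
    using arg_cong[OF comm[of "matrix_unit p q"], of "\<lambda>N. N $ k $ q"]
    by (simp add: matmul_matrix_unit matrix_unit_matmul)
  have diag: "T $ i $ i = T $ q $ q" for i q
    using *[of i i q] by simp
  have "trace T = (\<Sum>i\<in>(UNIV :: 'n set). T $ q $ q)" for q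
    unfolding trace_def by (intro sum.cong refl diag)
  then have "T $ q $ q = 0" for q
    using tr by simp
  then have "T $ k $ p = 0" for k p
    by (subst *[of k p k]) simp
  then show ?thesis
    by (simp add: vec_eq_iff)
qed

lemma inner_derivation_eq_imp_eq:
  fixes S T :: "complex^'n^'n"
  assumes "trace S = 0" "trace T = 0" "\<And>a. S ** a - a ** S = T ** a - a ** T"
  shows "S = T"
proof -
  have "(S - T) ** a = a ** (S - T)" for a
    using assms(3)[of a] by (simp add: matmul.diff_left matmul.diff_right algebra_simps)
  then have "S - T = 0"
    by (rule commuting_traceless_eq_zero) (simp add: trace_sub assms)
  then show ?thesis
    by simp
qed

lemma theta_eqI:
  fixes T :: "complex^'n^'n"
  assumes "trace T = 0" "\<And>a. X a = T ** a - a ** T"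
  shows "theta X = T"
  unfolding theta_def using assms by (intro the_equality) (auto intro: inner_derivation_eq_imp_eq)

text \<open>Apply \<open>X\<close> to \<open>a ** matrix_unit q o'\<close> in two ways, by linearity
  and by the Leibniz rule, and read off column \<open>o'\<close>: this expresses \<open>X a\<close>
  through the matrix \<open>T\<close> of values on that column.\<close>

lemma derivation_inner:
  assumes "X \<in> Der"
  shows "\<exists>T :: complex^'n^'n. trace T = 0 \<and> (\<forall>a. X a = T ** a - a ** T)"
proof -
  interpret X: Vector_Spaces.linear cscale cscale X
    using assms by (simp add: Der_def)
  define o' where "o' = (undefined :: 'n)"
  define T :: "complex^'n^'n" where "T = (\<chi> p q. X (matrix_unit q o') $ p $ o')"
  have T: "X a = T ** a - a ** T" for a
  proof -
    have "(X a + a ** T) $ p $ q = (T ** a) $ p $ q" for p q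
    proof -
      have "a ** matrix_unit q o' = (\<Sum>k\<in>UNIV. cscale (a $ k $ q) (matrix_unit k o'))"
        by (simp add: vec_eq_iff matmul_matrix_unit cscale_def) (simp add: matrix_unit_def if_distrib[of "\<lambda>z. _ * z"] cong: if_cong)
      then have "X (a ** matrix_unit q o') = (\<Sum>k\<in>UNIV. cscale (a $ k $ q) (X (matrix_unit k o')))"
        by (simp add: X.sum X.scale)
      then have "X (a ** matrix_unit q o') $ p $ o' = (\<Sum>k\<in>UNIV. a $ k $ q * T $ p $ k)"
        by (simp add: cscale_def T_def)
      also have "\<dots> = (T ** a) $ p $ q"
        by (simp add: matrix_matrix_mult_def mult.commute)
      finally have 1: "X (a ** matrix_unit q o') $ p $ o' = (T ** a) $ p $ q" .
      have "X (a ** matrix_unit q o') = X a ** matrix_unit q o' + a ** X (matrix_unit q o')"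
        using assms by (simp add: Der_def)
      then have "X (a ** matrix_unit q o') $ p $ o' = X a $ p $ q + (a ** T) $ p $ q"
        by (simp add: matmul_matrix_unit) (simp add: matrix_matrix_mult_def T_def)
      with 1 show ?thesis
        by simp
    qed
    then have "X a + a ** T = T ** a"
      by (simp add: vec_eq_iff)
    then show ?thesis
      by (simp add: algebra_simps)
  qed
  \<comment> \<open>Subtracting a scalar matrix leaves the commutator unchanged; this scalar makes
    the trace zero.\<close>
  define c where "c = trace T / of_nat CARD('n)"
  have "mat c ** a = a ** mat c" for a :: "complex^'n^'n"
    by (simp add: vec_eq_iff matrix_matrix_mult_def mat_def if_distrib[of "\<lambda>z. z * _"]
        if_distrib[of "\<lambda>z. _ * z"] mult.commute cong: if_cong)
  then have "X a = (T - mat c) ** a - a ** (T - mat c)" for a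
    using T[of a] by (simp add: matmul.diff_left matmul.diff_right)
  moreover have "trace (T - mat c) = 0"
    by (simp add: trace_sub) (simp add: trace_def mat_def c_def)
  ultimately show ?thesis
    by blast
qed

lemma theta:
  assumes "X \<in> Der"
  shows "trace (theta X) = 0" "X a = theta X ** a - a ** theta X"
  using derivation_inner[OF assms] theta_eqI[of _ X] by auto

text \<open>For real \<open>X\<close>, the traceless matrix \<open>- hconj (theta X)\<close>
  implements \<open>X\<close> too, so uniqueness applies.\<close>

lemma hconj_theta:
  assumes "X \<in> Der" "star X = X"
  shows "hconj (theta X) = - theta X"
proof -
  have "X a = (- hconj (theta X)) ** a - a ** (- hconj (theta X))" for a
  proof -
    have "X a = hconj (X (hconj a))"
      using fun_cong[OF assms(2), of a] by (simp add: star_def)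
    also have "\<dots> = a ** hconj (theta X) - hconj (theta X) ** a"
      by (subst theta(2)[OF assms(1)]) (simp add: hconj_diff hconj_mult)
    finally show ?thesis
      by (simp add: matmul.minus_left matmul.minus_right)
  qed
  moreover have "trace (- hconj (theta X)) = 0"
    using theta(1)[OF assms(1)] by (simp add: linear_neg[OF linear_trace] trace_hconj)
  ultimately have "theta X = - hconj (theta X)"
    by (intro theta_eqI)
  then show ?thesis
    by (metis minus_minus)
qed

section \<open>Gauge potentials and holonomies\<close>

text \<open>This is \<open>B(X)\<close>: adding \<open>s ** theta X\<close> cancels the Leibniz
  term, which leaves a right-linear map.\<close>

definition gauge_potential :: "('n::finite, 'm::finite) conn \<Rightarrow> 'n endo \<Rightarrow> complex^'m^'m" where
  "gauge_potential D X = matrix_of_endo (\<lambda>s. D X s + s ** theta X)"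

lemma connection_eq_gauge_potential:
  assumes "connection g D" "X \<in> g" "X \<in> Der"
  shows "D X s = gauge_potential D X ** s - s ** theta X"
proof -
  have add: "D X (s + t) = D X s + D X t" for s t
    using assms by (simp add: connection_def Vector_Spaces.linear_iff)
  have leibniz: "D X (s ** a) = D X s ** a + s ** X a" for s a
    using assms by (simp add: connection_def)
  have "D X s + s ** theta X = gauge_potential D X ** s"
    unfolding gauge_potential_def
    by (rule right_linear_imp_left_mult)
       (simp_all add: add leibniz theta(2)[OF assms(3)] matmul.add_left matmul.add_right
          matmul.diff_right matrix_mul_assoc)
  then show ?thesis
    by (simp add: algebra_simps)
qed

text \<open>Used with arbitrary real \<open>t\<close> for differentiation and with
  \<open>t = - 1\<close> for adjoints.\<close>

lemma gauge_potential_scaleR: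
  assumes D: "connection g D" and X: "X \<in> g" "X \<in> Der"
  shows "gauge_potential D (\<lambda>a. cscale (of_real t) (X a)) = t *\<^sub>R gauge_potential D X"
proof -
  let ?Y = "\<lambda>a. cscale (of_real t) (X a)"
  have theta: "theta ?Y = t *\<^sub>R theta X"
    using theta[OF X(2)]
    by (intro theta_eqI)
       (simp_all add: linear_scale[OF linear_trace] cscale_of_real matmul.scaleR_left matmul.scaleR_right scaleR_diff_right)
  have "D ?Y s = cscale (of_real t) (D X s)" for s
    using D X(1) by (simp add: connection_def)
  then have "D ?Y s + s ** theta ?Y = (t *\<^sub>R gauge_potential D X) ** s" for s
    using connection_eq_gauge_potential[OF D X, of s] theta
    by (simp add: cscale_of_real matmul.scaleR_left matmul.scaleR_right scaleR_diff_right)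
  then show ?thesis
    unfolding gauge_potential_def[of D ?Y] by (rule matrix_of_endo_eqI)
qed

text \<open>Since \<open>theta X\<close> is antihermitian, its terms in the hermiticity condition
  account exactly for \<open>X (herm s t)\<close>, and only the hermitian part of \<open>?B\<close>
  is left.\<close>

lemma hconj_gauge_potential:
  fixes D :: "('n::finite, 'm::finite) conn"
  assumes D: "hermitian_connection g D" and X: "X \<in> g" "X \<in> Der" "star X = X"
  shows "hconj (gauge_potential D X) = - gauge_potential D X"
proof -
  let ?B = "gauge_potential D X"
  have D': "D X s = ?B ** s - s ** theta X" for s
    using D X by (intro connection_eq_gauge_potential) (auto simp: hermitian_connection_def)
  have "hconj s ** ((hconj ?B + ?B) ** t) = 0" for s t :: "complex^'n^'m"
  proof -
    have "X (herm s t) = herm (D (star X) s) t + herm s (D X t)"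
      using D X(1) unfolding hermitian_connection_def by blast
    then show ?thesis
      by (simp add: herm_def X(3) D' theta(2)[OF X(2)] hconj_diff hconj_mult hconj_theta[OF X(2,3)]
          matmul.add_left matmul.add_right matmul.diff_left matmul.diff_right matmul.minus_left
          matmul.minus_right matrix_mul_assoc algebra_simps)
  qed
  \<comment> \<open>Conjugation puts the arbitrary \<open>s\<close> on the right, where
    \<open>matmul_eq_zero_imp\<close> can cancel it.\<close>
  then have "hconj ((hconj ?B + ?B) ** t) ** s = 0" for s t :: "complex^'n^'m"
    by (metis hconj_hconj hconj_mult linear_0[OF linear_hconj])
  then have "hconj ((hconj ?B + ?B) ** t) = 0" for t :: "complex^'n^'m"
    by (rule matmul_eq_zero_imp)
  then have "(hconj ?B + ?B) ** t = 0" for t :: "complex^'n^'m"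
    by (metis hconj_hconj linear_0[OF linear_hconj])
  then have "hconj ?B + ?B = 0"
    by (rule matmul_eq_zero_imp)
  then show ?thesis
    by (simp add: eq_neg_iff_add_eq_0)
qed

section \<open>Parallel transport and holonomies of words\<close>

lemma linear_transport_eq:
  assumes "connection g D" "X \<in> g" "X \<in> Der"
  shows "linear_transport D X 1 s = mat_exp (gauge_potential D X) ** s"
proof -
  let ?B = "gauge_potential D X" and ?T = "theta X"
  note D = connection_eq_gauge_potential[OF assms]
  have lin: "linear (D X)"
    unfolding D by (intro linear_compose_sub linear_matmul_left linear_matmul_right)
  \<comment> \<open>Left multiplication by \<open>?B\<close> commutes with right multiplication by
    \<open>?T\<close>, so the exponents add and the \<open>?T\<close> terms cancel.\<close>
  have "endo_exp (\<lambda>s. s ** ?T) (endo_exp (D X) s) = endo_exp (\<lambda>s. s ** ?T + D X s) s"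
    by (rule endo_exp_add[OF linear_matmul_right lin, symmetric])
       (simp add: D matmul.diff_left matrix_mul_assoc)
  also have "(\<lambda>s. s ** ?T + D X s) = (\<lambda>s. ?B ** s)"
    by (simp add: D)
  finally show ?thesis
    by (simp add: linear_transport_def transport_def mult_mat_exp mat_exp_mult)
qed

definition holonomy :: "('n::finite, 'm::finite) conn \<Rightarrow> 'n endo list \<Rightarrow> complex^'m^'m" where
  "holonomy D Xs = foldr (\<lambda>X M. mat_exp (gauge_potential D X) ** M) Xs (mat 1)"

lemma holonomy_Nil [simp]: "holonomy D [] = mat 1"
  and holonomy_Cons: "holonomy D (X # Xs) = mat_exp (gauge_potential D X) ** holonomy D Xs"
  by (simp_all add: holonomy_def)

lemma holonomy_append: "holonomy D (Xs @ Ys) = holonomy D Xs ** holonomy D Ys"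
  by (induction Xs) (simp_all add: holonomy_Cons matrix_mul_assoc)

lemma wilson_eq_trace_holonomy:
  assumes "connection g D" "set Xs \<subseteq> g" "g \<subseteq> Der"
  shows "wilson Xs D = trace (holonomy D Xs)"
proof -
  have "foldr (\<lambda>X F. linear_transport D X 1 \<circ> F) Xs id s = holonomy D Xs ** s" for s
    using assms(2)
  proof (induction Xs)
    case (Cons X Xs)
    then show ?case
      using linear_transport_eq[OF assms(1), of X] assms(3)
      by (auto simp: holonomy_Cons matrix_mul_assoc)
  qed simp
  then show ?thesis
    unfolding wilson_def by (simp add: matrix_of_endo_eqI)
qed

lemma real_derivations_scaleR:
  assumes "lie_subalgebra_Der g" "X \<in> real_derivations g"
  shows "(\<lambda>a. cscale (of_real t) (X a)) \<in> real_derivations g"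
proof -
  have "star (\<lambda>a. cscale (of_real t) (X a)) = (\<lambda>a. cscale (of_real t) (star X a))"
    by (simp add: star_def cscale_of_real hconj_scaleR)
  then show ?thesis
    using assms by (auto simp: real_derivations_def lie_subalgebra_Der_def)
qed

text \<open>Antihermitian potentials turn the adjoint of each factor into the factor of
  \<open>- X\<close>, and adjoints reverse products; so the adjoint is again the holonomy of a
  word.\<close>

lemma hconj_holonomy:
  assumes g: "lie_subalgebra_Der g" and D: "hermitian_connection g D"
    and "set Xs \<subseteq> real_derivations g"
  shows "hconj (holonomy D Xs) = holonomy D (rev (map (\<lambda>X a. cscale (of_real (- 1)) (X a)) Xs))"
  using assms(3)
proof (induction Xs)
  case (Cons X Xs)
  then have X: "X \<in> g" "X \<in> Der" "star X = X"
    using g by (auto simp: real_derivations_def lie_subalgebra_Der_def)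
  have "connection g D"
    using D by (simp add: hermitian_connection_def)
  from gauge_potential_scaleR[OF this X(1,2), of "- 1"]
  have "gauge_potential D (\<lambda>a. cscale (of_real (- 1)) (X a)) = hconj (gauge_potential D X)"
    using hconj_gauge_potential[OF D X] by simp
  with Cons show ?case
    by (simp add: holonomy_Cons holonomy_append hconj_mult hconj_mat_exp)
qed simp

section \<open>From equal observables to a gauge transformation\<close>

theorem theorem3p5:
  fixes g :: "(complex^'n^'n \<Rightarrow> complex^'n^'n) set"
    and D D' :: "('n::finite, 'm::finite) conn"
  assumes "lie_subalgebra_Der g"
    and "\<forall>X\<in>g. star X \<in> g"
    and "hermitian_connection g D"
    and "hermitian_connection g D'"
    and "\<forall>W\<in>observables g. W D = W D'"
  shows "gauge_equivalent g D D'"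
proof -
  note g = assms(1) and D = assms(3) and D' = assms(4)
  let ?R = "real_derivations g"
  have R: "?R \<subseteq> g" and Der: "g \<subseteq> Der"
    using g by (auto simp: real_derivations_def lie_subalgebra_Der_def)
  have conn: "connection g D" "connection g D'"
    using D D' by (auto simp: hermitian_connection_def)
  \<comment> \<open>Partners share the same word; a relation avoids asking that equal holonomies of
    \<open>D\<close> have equal partners.\<close>
  define P where "P = {(holonomy D Xs, holonomy D' Xs) | Xs. set Xs \<subseteq> ?R}"
  have "\<exists>u\<in>unitary_group. \<forall>(a, a')\<in>P. u ** a = a' ** u"
  proof (rule unitary_equivalence_if_trace_eq[of P])
    show "(mat 1, mat 1) \<in> P"
      by (auto simp: P_def intro!: exI[of _ "[]"])
  next
    fix a a' b b' assume "(a, a') \<in> P" "(b, b') \<in> P"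
    then obtain Xs Ys where XYs: "set (Xs @ Ys) \<subseteq> ?R"
      and "a = holonomy D Xs" "a' = holonomy D' Xs" "b = holonomy D Ys" "b' = holonomy D' Ys"
      by (auto simp: P_def)
    then have "a ** b = holonomy D (Xs @ Ys)" "a' ** b' = holonomy D' (Xs @ Ys)"
      by (simp_all add: holonomy_append)
    with XYs show "(a ** b, a' ** b') \<in> P"
      unfolding P_def by blast
  next
    fix a a' assume "(a, a') \<in> P"
    then obtain Xs where Xs: "set Xs \<subseteq> ?R" "a = holonomy D Xs" "a' = holonomy D' Xs"
      by (auto simp: P_def)
    let ?Ys = "rev (map (\<lambda>X a. cscale (of_real (- 1)) (X a)) Xs)"
    have "set ?Ys \<subseteq> ?R"
      using Xs(1) real_derivations_scaleR[OF g] by (auto simp del: of_real_minus)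
    moreover have "hconj a = holonomy D ?Ys" "hconj a' = holonomy D' ?Ys"
      using Xs hconj_holonomy[OF g D] hconj_holonomy[OF g D'] by blast+
    ultimately show "(hconj a, hconj a') \<in> P"
      unfolding P_def by blast
  next
    fix a a' assume "(a, a') \<in> P"
    then obtain Xs where Xs: "set Xs \<subseteq> ?R" "a = holonomy D Xs" "a' = holonomy D' Xs"
      by (auto simp: P_def)
    then have "wilson Xs \<in> observables g"
      by (auto simp: observables_def)
    then have "wilson Xs D = wilson Xs D'"
      using assms(5) by blast
    then show "trace a = trace a'"
      using Xs R wilson_eq_trace_holonomy[OF conn(1) _ Der, of Xs]
        wilson_eq_trace_holonomy[OF conn(2) _ Der, of Xs] by auto
  qed
  then obtain u where u: "u \<in> unitary_group" and tw: "\<And>a a'. (a, a') \<in> P \<Longrightarrow> u ** a = a' ** u"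
    by blast
  have real: "D' X s = gauge_transform u D X s" if X: "X \<in> ?R" for X s
  proof -
    have X': "X \<in> g" "X \<in> Der"
      using X R Der by auto
    \<comment> \<open>One-letter words in real multiples of \<open>X\<close> supply the whole
      one-parameter group.\<close>
    have "u ** mat_exp (t *\<^sub>R gauge_potential D X) = mat_exp (t *\<^sub>R gauge_potential D' X) ** u" for t
    proof -
      let ?Y = "\<lambda>a. cscale (of_real t) (X a)"
      have "set [?Y] \<subseteq> ?R"
        using real_derivations_scaleR[OF g X] by simp
      then have "(holonomy D [?Y], holonomy D' [?Y]) \<in> P"
        unfolding P_def by blast
      from tw[OF this] show ?thesis
        using gauge_potential_scaleR[OF conn(1) X'] gauge_potential_scaleR[OF conn(2) X']
        by (simp add: holonomy_Cons)
    qed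
    then have B: "u ** gauge_potential D X = gauge_potential D' X ** u"
      by (rule mat_exp_intertwines)
    have "gauge_transform u D X s
        = u ** gauge_potential D X ** (hconj u ** s) - u ** hconj u ** s ** theta X"
      by (simp add: gauge_transform_def connection_eq_gauge_potential[OF conn(1) X']
          matmul.diff_right matrix_mul_assoc)
    also have "\<dots> = gauge_potential D' X ** (u ** hconj u) ** s - u ** hconj u ** s ** theta X"
      by (simp add: B matrix_mul_assoc)
    also have "\<dots> = D' X s"
      using u by (simp add: unitary_group_def connection_eq_gauge_potential[OF conn(2) X'])
    finally show ?thesis ..
  qed
  have "D' X s = gauge_transform u D X s" if X: "X \<in> g" for X s
  proof -
    \<comment> \<open>The real and imaginary parts of \<open>X\<close>, with
      \<open>X = Y + \<i> Z\<close>; they lie in \<open>g\<close> because \<open>g\<close> is closed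
      under \<open>star\<close>.\<close>
    define Y where "Y = (\<lambda>a. cscale (1 / 2) (X a + star X a))"
    define Z where "Z = (\<lambda>a. cscale (- \<i> / 2) (X a + cscale (- 1) (star X a)))"
    have mem: "star X \<in> g"
      using assms(2) X by blast
    have add: "(\<lambda>a. V a + W a) \<in> g" if "V \<in> g" "W \<in> g" for V W
      using g that by (simp add: lie_subalgebra_Der_def)
    have scale: "(\<lambda>a. cscale c (V a)) \<in> g" if "V \<in> g" for V c
      using g that by (simp add: lie_subalgebra_Der_def)
    have Yg: "Y \<in> g" and Zg: "Z \<in> g"
      unfolding Y_def Z_def by (intro scale add X mem)+
    have "star Y = Y" "star Z = Z"
      by (simp_all add: fun_eq_iff Y_def Z_def star_def cscale_def hconj_def vec_eq_iff algebra_simps)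
    with Yg Zg have YZ: "Y \<in> ?R" "Z \<in> ?R"
      by (simp_all add: real_derivations_def)
    have X_eq: "X = (\<lambda>a. Y a + cscale \<i> (Z a))"
      by (simp add: fun_eq_iff Y_def Z_def cscale_def vec_eq_iff field_simps)
    have split: "E X s = E Y s + cscale \<i> (E Z s)" if "connection g E" for E s
      using that Yg Zg scale[OF Zg, of \<i>] by (subst X_eq) (simp add: connection_def)
    have lin: "u ** cscale c s = cscale c (u ** s)" for c s
      by (simp add: cscale_def matrix_matrix_mult_def vec_eq_iff sum_distrib_left mult_ac)
    have "D' X s = gauge_transform u D Y s + cscale \<i> (gauge_transform u D Z s)"
      by (simp add: split[OF conn(2)] real YZ)
    also have "\<dots> = gauge_transform u D X s"
      by (simp add: gauge_transform_def split[OF conn(1)] matmul.add_right lin)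
    finally show ?thesis .
  qed
  with u show ?thesis
    unfolding gauge_equivalent_def by blast
qed

end
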